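(* Let $\mathsf{G}$ and $\mathsf{L}$ be the $m\times m$ collocation and evaluation matrices defined in the context, and assume that both are invertible. Let $s$ be the approximant constructed at the full set of collocation points/centers $X=\{\bar{x}_1,\dots,\bar{x}_m\}$, i.e. $$s(\bar{x})=\sum_{j=1}^m c_j\,\lambda_{\bar{x}_j}^{(2)}(\kappa(\bar{x},\cdot)),\qquad \mathsf{G}\bar{c}=\bar{g},\quad \bar{c}=(c_1,\dots,c_m)^\intercal .$$ Let $X_\ell=\{\bar{x}_{p_1},\dots,\bar{x}_{p_v}\}$ be a validation fold with vector of distinct indices $\bar{p}=(p_1,\dots,p_v)^\intercal$, and assume that the $v\times v$ matrix $(\mathsf{G}^{-1})_{\bar{p},\bar{p}}$ is invertible. Let $s^{(\bar{p})}$ be the approximant built by excluding the functionals related to the nodes in $X_\ell$, i.e. $$s^{(\bar{p})}(\bar{x})=\sum_{j:\,\bar{x}_j\notin X_\ell} c_j^{(\bar{p})}\,\lambda_{\bar{x}_j}^{(2)}(\kappa(\bar{x},\cdot)),$$ where the $(m-v)$-dimensional coefficient vector $\bar{c}^{(\bar{p})}=(c_j^{(\bar p)})_{j:\,\bar{x}_j\notin X_\ell}$ solves $\mathsf{G}^{\bar{p},\bar{p}}\bar{c}^{(\bar{p})}=\bar{g}^{\bar{p}}$. Let $\bar{h}=(h(\bar{x}_1),\dots,h(\bar{x}_m))^\intercal$, let $\bar{f}=\mathsf{L}\mathsf{G}^{-1}\bar{g}$, and let $$\bar{e}_{\bar{p}}=\bar{h}_{\bar{p}}-\bar{s}^{(\bar{p})}(X_\ell),\qquad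 \bar{s}^{(\bar{p})}(X_\ell)=(s^{(\bar{p})}(\bar{x}_{p_1}),\dots,s^{(\bar{p})}(\bar{x}_{p_v}))^\intercal,$$ be the vector of signed validation errors. Define its approximation (the surrogate validation error) $$\bar{\epsilon}_{\bar{p}}=((\mathsf{L}^{-1})_{:,\bar{p}})^+(\mathsf{G}^{-1})_{:,\bar{p}}((\mathsf{G}^{-1})_{\bar{p},\bar{p}})^{-1}(\mathsf{G}^{-1}\bar{g})_{\bar{p}}-\bar{f}_{\bar{p}}+\bar{h}_{\bar{p}}.$$ If the residual $$\big\lVert \big((\mathsf{L}^{-1})_{:,\bar{p}}((\mathsf{L}^{-1})_{:,\bar{p}})^+-\mathsf{I}\big)(\mathsf{G}^{-1})_{:,\bar{p}}((\mathsf{G}^{-1})_{\bar{p},\bar{p}})^{-1}(\mathsf{G}^{-1}\bar{g})_{\bar{p}}\big\rVert_2$$ is equal to zero, where $\mathsf{I}$ is the $m\times m$ identity matrix, then $\bar{e}_{\bar{p}}=\bar{\epsilon}_{\bar{p}}$.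
   Context: Setting. $\Omega\subset\mathbb{R}^d$; $\kappa:\Omega\times\Omega\to\mathbb{R}$ is a strictly positive definite radial kernel, i.e. $\kappa(\bar{x},\bar{y})=\varphi(\lVert\bar{x}-\bar{y}\rVert)$ for some $\varphi:[0,\infty)\to\mathbb{R}$. $X=\{\bar{x}_1,\dots,\bar{x}_m\}\subset\Omega$ is a set of $m$ distinct points, used both as collocation points and as centers. Associated with the points are distinct linear functionals $\gamma_{\bar{x}_1},\dots,\gamma_{\bar{x}_m}$ and distinct linear functionals $\lambda_{\bar{x}_1},\dots,\lambda_{\bar{x}_m}$ acting on real-valued functions on $\Omega$ (all applications below are assumed well defined). The function $h:\Omega\to\mathbb{R}$ is the underlying (target) function and $\bar{g}=(\gamma_{\bar{x}_1}(h),\dots,\gamma_{\bar{x}_m}(h))^\intercal$. A superscript $(1)$ or $(2)$ on a functional means it acts on $\kappa$ as a function of its first or second input, respectively. The collocation matrix is $\mathsf{G}_{i,j}=\gamma_{\bar{x}_i}^{(1)}\lambda_{\bar{x}_j}^{(2)}\kappa$, and the evaluation matrix is $\mathsf{L}_{i,j}=\delta_{\bar{x}_i}^{(1)}\lambda_{\bar{x}_j}^{(2)}\kappa$, where $\delta_{\bar{x}}(u)=u(\bar{x})$ is point evaluation; that is, $\mathsf{L}_{i,j}$ is the value at $\bar{x}=\bar{x}_i$ of the function $\bar{x}\mapsto\lambda_{\bar{x}_j}^{(2)}(\kappa(\bar{x},\cdot))$. Folds. $X$ is partitioned into $k\le m$ disjoint non-empty subsets $X_1,\dots,X_k$, each of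 cardinality $v=m/k\in\mathbb{N}$; $X_\ell$ is one of them, and $\bar{p}=(p_1,\dots,p_v)^\intercal$ is the vector of distinct indices in $\{1,\dots,m\}$ of its elements. Notation. For an $m$-vector $\bar{z}$, $\bar{z}_{\bar{p}}$ is the $v$-vector of entries with index in $\bar{p}$ and $\bar{z}^{\bar{p}}$ the $(m-v)$-vector of entries with index not in $\bar{p}$. For an $m\times m$ matrix $\mathsf{A}$, $\mathsf{A}_{\bar{p},\bar{p}}$ is the $v\times v$ submatrix of rows and columns with index in $\bar{p}$, $\mathsf{A}^{\bar{p},\bar{p}}$ the $(m-v)\times(m-v)$ submatrix of rows and columns with index not in $\bar{p}$, and $\mathsf{A}_{:,\bar{p}}$ the $m\times v$ submatrix of columns with index in $\bar{p}$. $\mathsf{A}^+$ denotes the Moore-Penrose pseudoinverse. *)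

theory Defs
  imports
    "HOL-Analysis.Euclidean_Space"
    "HOL-Library.Disjoint_Sets"
    "Jordan_Normal_Form.Gauss_Jordan_Elimination"
begin

section \<open>Kernels\<close>

definition strictly_pos_def_kernel :: "'a set \<Rightarrow> ('a \<Rightarrow> 'a \<Rightarrow> real) \<Rightarrow> bool" where
  "strictly_pos_def_kernel \<Omega> \<kappa> \<longleftrightarrow>
     (\<forall>Y c. finite Y \<and> Y \<subseteq> \<Omega> \<and> (\<exists>y\<in>Y. c y \<noteq> 0) \<longrightarrow>
        (\<Sum>y\<in>Y. \<Sum>z\<in>Y. c y * c z * \<kappa> y z) > 0)"

definition radial_kernel :: "'a::real_normed_vector set \<Rightarrow> ('a \<Rightarrow> 'a \<Rightarrow> real) \<Rightarrow> bool" where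
  "radial_kernel \<Omega> \<kappa> \<longleftrightarrow> (\<exists>\<phi>. \<forall>x\<in>\<Omega>. \<forall>y\<in>\<Omega>. \<kappa> x y = \<phi> (norm (x - y)))"

section \<open>Linear functionals on functions on \<open>\<Omega>\<close>\<close>

text \<open>
  A function on \<open>\<Omega>\<close> is represented by any total function with the right values on \<open>\<Omega>\<close>. A
  functional such as a differential operator at a point is only defined on some of these
  functions, so it comes with a domain \<open>D\<close>; membership in \<open>D\<close> expresses that its application
  is well defined. The last conjunct of each of the next two definitions makes \<open>D\<close> and the
  functional insensitive to the values outside \<open>\<Omega>\<close>.
\<close>

definition function_space :: "'a set \<Rightarrow> ('a \<Rightarrow> real) set \<Rightarrow> bool" where
  "function_space \<Omega> D \<longleftrightarrow>
     (\<lambda>_. 0) \<in> D \<and>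
     (\<forall>u\<in>D. \<forall>w\<in>D. (\<lambda>x. u x + w x) \<in> D) \<and>
     (\<forall>a. \<forall>u\<in>D. (\<lambda>x. a * u x) \<in> D) \<and>
     (\<forall>u\<in>D. \<forall>w. (\<forall>x\<in>\<Omega>. w x = u x) \<longrightarrow> w \<in> D)"

definition linear_functional :: "'a set \<Rightarrow> ('a \<Rightarrow> real) set \<Rightarrow> (('a \<Rightarrow> real) \<Rightarrow> real) \<Rightarrow> bool" where
  "linear_functional \<Omega> D F \<longleftrightarrow>
     (\<forall>u\<in>D. \<forall>w\<in>D. F (\<lambda>x. u x + w x) = F u + F w) \<and>
     (\<forall>a. \<forall>u\<in>D. F (\<lambda>x. a * u x) = a * F u) \<and>
     (\<forall>u\<in>D. \<forall>w\<in>D. (\<forall>x\<in>\<Omega>. u x = w x) \<longrightarrow> F u = F w)"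

definition distinct_linear_functionals ::
    "'a set \<Rightarrow> ('a \<Rightarrow> real) set \<Rightarrow> nat \<Rightarrow> (nat \<Rightarrow> ('a \<Rightarrow> real) \<Rightarrow> real) \<Rightarrow> bool" where
  "distinct_linear_functionals \<Omega> D m F \<longleftrightarrow>
     function_space \<Omega> D \<and>
     (\<forall>i<m. linear_functional \<Omega> D (F i)) \<and>
     (\<forall>i<m. \<forall>j<m. i \<noteq> j \<longrightarrow> (\<exists>u\<in>D. F i u \<noteq> F j u))"

definition point_eval :: "'a \<Rightarrow> ('a \<Rightarrow> real) \<Rightarrow> real" where
  "point_eval x u = u x"

section \<open>Collocation\<close>

text \<open>
  In \<open>F i (\<lambda>x. lam j (\<kappa> x))\<close> the functional \<open>lam j\<close> acts on the second input of the
  kernel and \<open>F i\<close> on the first. For \<open>F i = point_eval (x i)\<close> this is the evaluation matrix.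
\<close>

definition collocation_matrix ::
    "nat \<Rightarrow> (nat \<Rightarrow> ('a \<Rightarrow> real) \<Rightarrow> real) \<Rightarrow> (nat \<Rightarrow> ('a \<Rightarrow> real) \<Rightarrow> real) \<Rightarrow> ('a \<Rightarrow> 'a \<Rightarrow> real) \<Rightarrow> real mat"
  where
  "collocation_matrix m F lam \<kappa> = mat m m (\<lambda>(i, j). F i (\<lambda>x. lam j (\<kappa> x)))"

definition evaluation_matrix ::
    "nat \<Rightarrow> (nat \<Rightarrow> 'a) \<Rightarrow> (nat \<Rightarrow> ('a \<Rightarrow> real) \<Rightarrow> real) \<Rightarrow> ('a \<Rightarrow> 'a \<Rightarrow> real) \<Rightarrow> real mat"
  where
  "evaluation_matrix m x lam \<kappa> = collocation_matrix m (\<lambda>i. point_eval (x i)) lam \<kappa>"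

text \<open>The centers used are those with indices in the list \<open>js\<close>; \<open>c\<close> is indexed by position in \<open>js\<close>.\<close>

definition approximant ::
    "(nat \<Rightarrow> ('a \<Rightarrow> real) \<Rightarrow> real) \<Rightarrow> ('a \<Rightarrow> 'a \<Rightarrow> real) \<Rightarrow> nat list \<Rightarrow> real vec \<Rightarrow> 'a \<Rightarrow> real" where
  "approximant lam \<kappa> js c y = (\<Sum>j<length js. c $ j * lam (js ! j) (\<kappa> y))"

section \<open>Vectors and matrices\<close>

definition sub_vec :: "'b vec \<Rightarrow> nat list \<Rightarrow> 'b vec" where
  "sub_vec z is = vec (length is) (\<lambda>i. z $ (is ! i))"

definition sub_mat :: "'b mat \<Rightarrow> nat list \<Rightarrow> nat list \<Rightarrow> 'b mat" where
  "sub_mat A is js = mat (length is) (length js) (\<lambda>(i, j). A $$ (is ! i, js ! j))"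

definition sub_cols :: "'b mat \<Rightarrow> nat list \<Rightarrow> 'b mat" where
  "sub_cols A js = sub_mat A [0..<dim_row A] js"

definition compl_indices :: "nat \<Rightarrow> nat list \<Rightarrow> nat list" where
  "compl_indices m p = filter (\<lambda>j. j \<notin> set p) [0..<m]"

definition inv_mat :: "'b::field mat \<Rightarrow> 'b mat" where
  "inv_mat A = the (mat_inverse A)"

lemma inv_mat:
  fixes A :: "'b::field mat"
  assumes A: "A \<in> carrier_mat n n" and inv: "invertible_mat A"
  shows "inv_mat A \<in> carrier_mat n n" "A * inv_mat A = 1\<^sub>m n" "inv_mat A * A = 1\<^sub>m n"
proof -
  obtain B where AB: "A * B = 1\<^sub>m n" and BA: "B * A = 1\<^sub>m (dim_row B)"
    using inv A unfolding invertible_mat_def inverts_mat_def by (metis carrier_matD(1))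
  have B: "B \<in> carrier_mat n n"
    using arg_cong[OF AB, of dim_col] arg_cong[OF BA, of dim_col] A by (intro carrier_matI) simp_all
  have "B * A = 1\<^sub>m n"
    using BA B by (metis carrier_matD(1))
  with A B AB have "A \<in> Units (ring_mat TYPE('b) n ())"
    unfolding Units_def ring_mat_def by auto
  then obtain C where C: "mat_inverse A = Some C"
    using mat_inverse(1)[OF A, where b = "()"] by (metis option.exhaust)
  show "inv_mat A \<in> carrier_mat n n" "A * inv_mat A = 1\<^sub>m n" "inv_mat A * A = 1\<^sub>m n"
    using mat_inverse(2)[OF A C] unfolding inv_mat_def C by simp_all
qed

text \<open>The four Penrose conditions, which have exactly one solution.\<close>

definition is_pinv :: "real mat \<Rightarrow> real mat \<Rightarrow> bool" where
  "is_pinv A B \<longleftrightarrow>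
     B \<in> carrier_mat (dim_col A) (dim_row A) \<and>
     A * B * A = A \<and> B * A * B = B \<and>
     transpose_mat (A * B) = A * B \<and> transpose_mat (B * A) = B * A"

definition pinv :: "real mat \<Rightarrow> real mat" where
  "pinv A = (THE B. is_pinv A B)"

definition vec_norm2 :: "real vec \<Rightarrow> real" where
  "vec_norm2 z = L2_set (\<lambda>i. z $ i) {..<dim_vec z}"

end

theory Submission
  imports Defs "Jordan_Normal_Form.Determinant"
begin

text \<open>
  Extend the reduced coefficient vector by zeros to \<open>d \<in> \<real>\<^sup>m\<close>. The full collocation
  system tested on \<open>d\<close> fails only in the rows of the fold, so \<open>G d = g - E b\<close>, where \<open>E\<close>
  consists of the unit vectors indexed by \<open>p\<close>, and \<open>d = G\<^sup>-\<^sup>1 g - (G\<^sup>-\<^sup>1)\<^sub>:\<^sub>,\<^sub>p b\<close>. Since \<open>d\<close> vanishes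
  on \<open>p\<close>, restricting this identity to \<open>p\<close> forces \<open>b = ((G\<^sup>-\<^sup>1)\<^sub>p\<^sub>,\<^sub>p)\<^sup>-\<^sup>1 (G\<^sup>-\<^sup>1 g)\<^sub>p\<close>; this is
  the extended Rippa formula, \<open>leave_out_coefficients\<close> below.

  With \<open>w = (G\<^sup>-\<^sup>1)\<^sub>:\<^sub>,\<^sub>p b\<close>, the reduced approximant at the nodes is \<open>L d = f - L w\<close>, and the
  validation error is \<open>h\<^sub>p - f\<^sub>p + (L w)\<^sub>p\<close>. The surrogate has \<open>P\<^sup>+ w\<close> in place of
  \<open>(L w)\<^sub>p\<close>, where \<open>P = (L\<^sup>-\<^sup>1)\<^sub>:\<^sub>,\<^sub>p\<close>. A zero residual says \<open>w = P P\<^sup>+ w\<close>; applying \<open>L\<close>, and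
  using \<open>L P = E\<close>, gives \<open>L w = E (P\<^sup>+ w)\<close>, whose entries on \<open>p\<close> are those of \<open>P\<^sup>+ w\<close>.

  As \<open>pinv\<close> is a definite description, even the dimensions of \<open>P\<^sup>+\<close> rest on existence and
  uniqueness of the pseudoinverse. Here \<open>P\<close> has a left inverse, so that
  \<open>(P\<^sup>T P)\<^sup>-\<^sup>1 P\<^sup>T\<close> is one.
\<close>

section \<open>The pseudoinverse of a matrix with a left inverse\<close>

text \<open>
  From \<open>A B = (A C)(A B)\<close> and \<open>(A B)(A C) = A C\<close>, transposing these symmetric products gives
  \<open>A B = A C\<close>, and likewise \<open>B A = C A\<close>. Then
  \<open>B = B A B = C A B = C A C = C\<close>.
\<close>

lemma is_pinv_unique:
  assumes B: "is_pinv A B" and C: "is_pinv A C"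
  shows "B = C"
proof -
  define m n where "m = dim_row A" and "n = dim_col A"
  have A: "A \<in> carrier_mat m n" by (simp add: m_def n_def)
  have Bc: "B \<in> carrier_mat n m" and Cc: "C \<in> carrier_mat n m"
    using B C unfolding is_pinv_def m_def n_def by auto
  have BA: "A * B * A = A" "B * A * B = B" "transpose_mat (A * B) = A * B"
      "transpose_mat (B * A) = B * A"
    and CA: "A * C * A = A" "C * A * C = C" "transpose_mat (A * C) = A * C"
      "transpose_mat (C * A) = C * A"
    using B C unfolding is_pinv_def by auto
  note AB = mult_carrier_mat[OF A Bc] and AC = mult_carrier_mat[OF A Cc]
    and BA' = mult_carrier_mat[OF Bc A] and CA' = mult_carrier_mat[OF Cc A]
  have "A * B = (A * C) * (A * B)"
    unfolding assoc_mult_mat[OF AC A Bc, symmetric] CA(1) ..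
  also have "\<dots> = transpose_mat ((A * B) * (A * C))"
    unfolding transpose_mult[OF AB AC] BA CA ..
  also have "(A * B) * (A * C) = A * C"
    unfolding assoc_mult_mat[OF AB A Cc, symmetric] BA(1) ..
  finally have AB_AC: "A * B = A * C" using CA(3) by simp
  have "B * A = (B * A) * (C * A)"
    unfolding assoc_mult_mat[OF Bc A CA'] assoc_mult_mat[OF A Cc A, symmetric] CA(1) ..
  also have "\<dots> = transpose_mat ((C * A) * (B * A))"
    unfolding transpose_mult[OF CA' BA'] BA CA ..
  also have "(C * A) * (B * A) = C * A"
    unfolding assoc_mult_mat[OF Cc A BA'] assoc_mult_mat[OF A Bc A, symmetric] BA(1) ..
  finally have BA_CA: "B * A = C * A" using CA(4) by simp
  have "B = C * A * B" using BA(2) BA_CA by simp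
  also have "\<dots> = C * A * C"
    unfolding assoc_mult_mat[OF Cc A Bc] assoc_mult_mat[OF Cc A Cc] AB_AC ..
  finally show ?thesis using CA(2) by simp
qed

lemma is_pinv_pinv: "is_pinv A B \<Longrightarrow> is_pinv A (pinv A)"
  unfolding pinv_def by (rule theI) (auto intro: is_pinv_unique)

text \<open>
  A matrix with a left inverse has trivial kernel, and over the reals \<open>A\<^sup>T A y = 0\<close> makes the
  squared length of \<open>A y\<close> zero.
\<close>

lemma gram_mat_inverse_if_left_inverse:
  fixes A :: "real mat"
  assumes A: "A \<in> carrier_mat n k" and C: "C \<in> carrier_mat k n" and CA: "C * A = 1\<^sub>m k"
  obtains B where "B \<in> carrier_mat k k" "B * (transpose_mat A * A) = 1\<^sub>m k"
    "transpose_mat A * A * B = 1\<^sub>m k"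
proof -
  let ?M = "transpose_mat A * A"
  have M: "?M \<in> carrier_mat k k" and At: "transpose_mat A \<in> carrier_mat k n" using A by auto
  have "det ?M \<noteq> 0"
  proof
    assume "det ?M = 0"
    then obtain y where y: "y \<in> carrier_vec k" "y \<noteq> 0\<^sub>v k" "?M *\<^sub>v y = 0\<^sub>v k"
      using det_0_iff_vec_prod_zero_field[OF M] by blast
    have Ay: "A *\<^sub>v y \<in> carrier_vec n" using A y by auto
    have "(A *\<^sub>v y) \<bullet> (A *\<^sub>v y) = (transpose_mat A *\<^sub>v (A *\<^sub>v y)) \<bullet> y"
      using transpose_vec_mult_scalar[OF A y(1) Ay] by simp
    also have "transpose_mat A *\<^sub>v (A *\<^sub>v y) = 0\<^sub>v k"
      using y(3) assoc_mult_mat_vec[OF At A y(1)] by simp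
    also have "0\<^sub>v k \<bullet> y = 0" using y(1) by simp
    finally have "A *\<^sub>v y = 0\<^sub>v n"
      using Ay conjugate_square_eq_0_vec[OF Ay] by simp
    moreover have "C *\<^sub>v 0\<^sub>v n = 0\<^sub>v k"
      using C by (auto simp: scalar_prod_def)
    ultimately have "y = 0\<^sub>v k"
      using assoc_mult_mat_vec[OF C A y(1)] CA y(1) by simp
    with y(2) show False by simp
  qed
  from det_non_zero_imp_unit[OF M this] show thesis
    by (auto simp: Units_def ring_mat_def intro: that)
qed

text \<open>The pseudoinverse here is \<open>(A\<^sup>T A)\<^sup>-\<^sup>1 A\<^sup>T\<close>, which inverts \<open>A\<close> from the left.\<close>

lemma pinv_carrier_if_left_inverse:
  fixes A :: "real mat"
  assumes A: "A \<in> carrier_mat n k" and C: "C \<in> carrier_mat k n" and CA: "C * A = 1\<^sub>m k"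
  shows "pinv A \<in> carrier_mat k n"
proof -
  obtain B where B: "B \<in> carrier_mat k k" "B * (transpose_mat A * A) = 1\<^sub>m k"
    "transpose_mat A * A * B = 1\<^sub>m k"
    using gram_mat_inverse_if_left_inverse[OF A C CA] .
  let ?T = "transpose_mat A"
  have T: "?T \<in> carrier_mat k n" using A by simp
  have Bt: "transpose_mat B \<in> carrier_mat k k" using B by simp
  have M: "?T * A \<in> carrier_mat k k" "transpose_mat (?T * A) = ?T * A"
    using A T by (auto simp: transpose_mult[OF T A])
  \<comment> \<open>The Gram matrix is symmetric, so its inverse is, being unique.\<close>
  have "transpose_mat B * (?T * A) = transpose_mat ((?T * A) * B)"
    using M transpose_mult[OF M(1) B(1)] by simp
  then have BtM: "transpose_mat B * (?T * A) = 1\<^sub>m k" using B by simp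
  have "transpose_mat B = transpose_mat B * ((?T * A) * B)" using B Bt by simp
  also have "\<dots> = B"
    using assoc_mult_mat[OF Bt M(1) B(1), symmetric] BtM B by simp
  finally have Bsym: "transpose_mat B = B" .
  have BT: "B * ?T \<in> carrier_mat k n" using B T by simp
  have 1: "(B * ?T) * A = 1\<^sub>m k" using assoc_mult_mat[OF B(1) T A] B by simp
  have 2: "A * (B * ?T) * A = A"
    using assoc_mult_mat[OF A BT A] 1 A by simp
  have 3: "transpose_mat (A * (B * ?T)) = A * (B * ?T)"
    using transpose_mult[OF A BT] transpose_mult[OF B(1) T] Bsym assoc_mult_mat[OF A B(1) T]
    by simp
  have "is_pinv A (B * ?T)"
    unfolding is_pinv_def
  proof (intro conjI)
    show "B * ?T \<in> carrier_mat (dim_col A) (dim_row A)" using BT A by simp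
    show "B * ?T * A * (B * ?T) = B * ?T" unfolding 1 by (rule left_mult_one_mat[OF BT])
    show "transpose_mat (B * ?T * A) = B * ?T * A" unfolding 1 by (rule transpose_one)
  qed (fact 2 3)+
  then have "is_pinv A (pinv A)" by (rule is_pinv_pinv)
  then show ?thesis using A unfolding is_pinv_def by simp
qed

section \<open>Selecting entries and columns\<close>

text \<open>
  \<open>sub_cols (1\<^sub>m m) p\<close> is the selection matrix whose columns are the unit vectors indexed by \<open>p\<close>.
  It extends a vector on the index list \<open>p\<close> by zeros, and multiplying by it from the right
  picks columns.
\<close>

lemma sub_vec_carrier [simp]: "sub_vec z p \<in> carrier_vec (length p)"
  by (simp add: sub_vec_def)

lemma sub_cols_carrier [simp]: "A \<in> carrier_mat n m \<Longrightarrow> sub_cols A p \<in> carrier_mat n (length p)"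
  by (simp add: sub_cols_def sub_mat_def)

lemma selection_mat_carrier [simp]: "sub_cols (1\<^sub>m m) p \<in> carrier_mat m (length p)"
  by (rule sub_cols_carrier) (rule one_carrier_mat)

lemma sub_mat_carrier [simp]: "sub_mat A p q \<in> carrier_mat (length p) (length q)"
  by (simp add: sub_mat_def)

lemma sub_cols_mult_vec_nth:
  assumes "A \<in> carrier_mat n m" "b \<in> carrier_vec (length p)" "i < n"
  shows "(sub_cols A p *\<^sub>v b) $ i = (\<Sum>k<length p. A $$ (i, p ! k) * b $ k)"
  using assms by (simp add: sub_cols_def sub_mat_def scalar_prod_def atLeast0LessThan)

lemma sub_cols_eq_mult:
  fixes A :: "'b::semiring_1 mat"
  assumes A: "A \<in> carrier_mat n m" and p: "set p \<subseteq> {..<m}"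
  shows "sub_cols A p = A * sub_cols (1\<^sub>m m) p"
proof (rule eq_matI)
  fix i k assume "i < dim_row (A * sub_cols (1\<^sub>m m) p)" "k < dim_col (A * sub_cols (1\<^sub>m m) p)"
  then have i: "i < n" and k: "k < length p" using A by (auto simp: sub_cols_def sub_mat_def)
  have pk: "p ! k < m" using p k nth_mem by blast
  have "(A * sub_cols (1\<^sub>m m) p) $$ (i, k) = (\<Sum>j<m. A $$ (i, j) * (if j = p ! k then 1 else 0))"
    using A i k pk
    by (simp add: sub_cols_def sub_mat_def scalar_prod_def atLeast0LessThan)
  also have "\<dots> = A $$ (i, p ! k)" using pk by (simp add: if_distrib cong: if_cong)
  finally show "sub_cols A p $$ (i, k) = (A * sub_cols (1\<^sub>m m) p) $$ (i, k)"
    using A i k by (simp add: sub_cols_def sub_mat_def)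
qed (use A in \<open>auto simp: sub_cols_def sub_mat_def\<close>)

lemma sub_cols_mult_vec:
  fixes A :: "'b::semiring_1 mat"
  assumes A: "A \<in> carrier_mat n m" and p: "set p \<subseteq> {..<m}" and b: "b \<in> carrier_vec (length p)"
  shows "sub_cols A p *\<^sub>v b = A *\<^sub>v (sub_cols (1\<^sub>m m) p *\<^sub>v b)"
  unfolding sub_cols_eq_mult[OF A p]
  by (rule assoc_mult_mat_vec[OF A _ b]) simp

lemma sub_mat_mult_vec:
  assumes "A \<in> carrier_mat n m" "set p \<subseteq> {..<n}" "b \<in> carrier_vec (length q)"
  shows "sub_mat A p q *\<^sub>v b = sub_vec (sub_cols A q *\<^sub>v b) p"
proof (rule eq_vecI)
  fix i assume "i < dim_vec (sub_vec (sub_cols A q *\<^sub>v b) p)"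
  then have i: "i < length p" by (simp add: sub_vec_def)
  then have "p ! i < n" using assms(2) nth_mem by blast
  then show "(sub_mat A p q *\<^sub>v b) $ i = sub_vec (sub_cols A q *\<^sub>v b) p $ i"
    using assms i
    by (simp add: sub_vec_def sub_cols_mult_vec_nth sub_mat_def scalar_prod_def atLeast0LessThan)
qed (simp add: sub_vec_def sub_mat_def)

lemma sub_vec_minus:
  assumes "y \<in> carrier_vec m" "z \<in> carrier_vec m" "set p \<subseteq> {..<m}"
  shows "sub_vec (y - z) p = sub_vec y p - sub_vec z p"
proof (rule eq_vecI)
  fix i assume "i < dim_vec (sub_vec y p - sub_vec z p)"
  then have i: "i < length p" by (simp add: sub_vec_def)
  then have "p ! i < m" using assms(3) nth_mem by blast
  then show "sub_vec (y - z) p $ i = (sub_vec y p - sub_vec z p) $ i"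
    using assms i by (simp add: sub_vec_def)
qed (simp add: sub_vec_def)

lemma extend_by_zero_nth:
  fixes b :: "'b::semiring_1 vec"
  assumes "b \<in> carrier_vec (length p)" "i < m" "set p \<subseteq> {..<m}"
  shows "(sub_cols (1\<^sub>m m) p *\<^sub>v b) $ i = (\<Sum>k<length p. if p ! k = i then b $ k else 0)"
proof -
  have "p ! k < m" if "k < length p" for k using that assms(3) nth_mem by blast
  then show ?thesis
    using assms by (subst sub_cols_mult_vec_nth[of _ m m]) (auto intro!: sum.cong)
qed

lemma extend_by_zero_nth_notin:
  fixes b :: "'b::semiring_1 vec"
  assumes "b \<in> carrier_vec (length p)" "i < m" "set p \<subseteq> {..<m}" "i \<notin> set p"
  shows "(sub_cols (1\<^sub>m m) p *\<^sub>v b) $ i = 0"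
  unfolding extend_by_zero_nth[OF assms(1-3)] using assms(4) by (auto intro!: sum.neutral)

lemma extend_by_zero_nth_in:
  fixes b :: "'b::semiring_1 vec"
  assumes "b \<in> carrier_vec (length p)" "set p \<subseteq> {..<m}" "distinct p" "k < length p"
  shows "(sub_cols (1\<^sub>m m) p *\<^sub>v b) $ (p ! k) = b $ k"
proof -
  have "p ! k < m" using assms(2,4) nth_mem by blast
  moreover have "(\<Sum>j<length p. if p ! j = p ! k then b $ j else 0)
      = (\<Sum>j<length p. if j = k then b $ j else 0)"
    using assms(3,4) by (intro sum.cong) (auto simp: nth_eq_iff_index_eq)
  ultimately show ?thesis using assms by (simp add: extend_by_zero_nth)
qed

lemma sub_vec_extend_by_zero:
  fixes b :: "'b::semiring_1 vec"
  assumes "b \<in> carrier_vec (length p)" "set p \<subseteq> {..<m}" "distinct p"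
  shows "sub_vec (sub_cols (1\<^sub>m m) p *\<^sub>v b) p = b"
  using assms by (auto simp: sub_vec_def vec_eq_iff extend_by_zero_nth_in)

lemma sub_vec_extend_by_zero_disjoint:
  fixes b :: "'b::semiring_1 vec"
  assumes "b \<in> carrier_vec (length q)" "set p \<subseteq> {..<m}" "set q \<subseteq> {..<m}" "set p \<inter> set q = {}"
  shows "sub_vec (sub_cols (1\<^sub>m m) q *\<^sub>v b) p = 0\<^sub>v (length p)"
proof (rule eq_vecI)
  fix i assume "i < dim_vec (0\<^sub>v (length p) :: 'b vec)"
  then have i: "i < length p" by simp
  then have "p ! i \<in> set p" by simp
  then have "p ! i < m" "p ! i \<notin> set q" using assms by auto
  then show "sub_vec (sub_cols (1\<^sub>m m) q *\<^sub>v b) p $ i = 0\<^sub>v (length p) $ i"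
    using i assms by (simp add: sub_vec_def extend_by_zero_nth_notin)
qed (simp add: sub_vec_def)

lemma extend_by_zero_sub_vec:
  fixes z :: "'b::semiring_1 vec"
  assumes z: "z \<in> carrier_vec m" and p: "set p \<subseteq> {..<m}" "distinct p"
    and off: "\<And>i. i < m \<Longrightarrow> i \<notin> set p \<Longrightarrow> z $ i = 0"
  shows "sub_cols (1\<^sub>m m) p *\<^sub>v sub_vec z p = z"
proof (rule eq_vecI)
  fix i assume "i < dim_vec z"
  then have i: "i < m" using z by simp
  show "(sub_cols (1\<^sub>m m) p *\<^sub>v sub_vec z p) $ i = z $ i"
  proof (cases "i \<in> set p")
    case True
    then obtain k where k: "k < length p" "p ! k = i" by (auto simp: in_set_conv_nth)
    then have "(sub_cols (1\<^sub>m m) p *\<^sub>v sub_vec z p) $ i = sub_vec z p $ k"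
      using extend_by_zero_nth_in[of "sub_vec z p" p m k] p by simp
    then show ?thesis using k by (simp add: sub_vec_def)
  next
    case False
    show ?thesis
      using off[OF i False] extend_by_zero_nth_notin[OF sub_vec_carrier i p(1) False] by simp
  qed
qed (use z in \<open>simp add: sub_cols_def sub_mat_def\<close>)

lemma set_compl_indices: "set (compl_indices m p) = {..<m} - set p"
  by (auto simp: compl_indices_def)

lemma length_compl_indices:
  assumes "distinct p" "set p \<subseteq> {..<m}"
  shows "length (compl_indices m p) = m - length p"
proof -
  have "length (compl_indices m p) = card (set (compl_indices m p))"
    by (rule distinct_card[symmetric]) (simp add: compl_indices_def)
  also have "\<dots> = m - length p"
    using assms by (simp add: set_compl_indices card_Diff_subset distinct_card)
  finally show ?thesis .
qed

section \<open>Leaving out a fold\<close>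

text \<open>
  The extended Rippa formula. The defect \<open>z = g - G d\<close> of the zero extension \<open>d\<close> is supported
  on \<open>p\<close>, so \<open>G\<^sup>-\<^sup>1 z\<close> involves only the columns of \<open>G\<^sup>-\<^sup>1\<close> indexed by \<open>p\<close>. As
  \<open>d = G\<^sup>-\<^sup>1 g - G\<^sup>-\<^sup>1 z\<close> vanishes on \<open>p\<close>, the entries of \<open>z\<close> there solve the linear system with
  matrix \<open>(G\<^sup>-\<^sup>1)\<^sub>p\<^sub>,\<^sub>p\<close> and right-hand side \<open>(G\<^sup>-\<^sup>1 g)\<^sub>p\<close>.
\<close>

lemma leave_out_coefficients:
  fixes G :: "'b::field mat" and m p
  defines "q \<equiv> compl_indices m p"
  assumes G: "G \<in> carrier_mat m m" "invertible_mat G"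
    and g: "g \<in> carrier_vec m"
    and p: "set p \<subseteq> {..<m}" "distinct p"
    and inv: "invertible_mat (sub_mat (inv_mat G) p p)"
    and cq: "cq \<in> carrier_vec (length q)" "sub_mat G q q *\<^sub>v cq = sub_vec g q"
  shows "sub_cols (1\<^sub>m m) q *\<^sub>v cq = inv_mat G *\<^sub>v g - sub_cols (inv_mat G) p *\<^sub>v
    (inv_mat (sub_mat (inv_mat G) p p) *\<^sub>v sub_vec (inv_mat G *\<^sub>v g) p)"
proof -
  let ?K = "inv_mat G" and ?N = "sub_mat (inv_mat G) p p"
  define d where "d = sub_cols (1\<^sub>m m) q *\<^sub>v cq"
  define z where "z = g - G *\<^sub>v d"
  define b where "b = sub_vec z p"
  have q: "set q = {..<m} - set p" by (simp add: q_def set_compl_indices)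
  have K: "?K \<in> carrier_mat m m" "?K * G = 1\<^sub>m m" using inv_mat[OF G] by auto
  have N: "?N \<in> carrier_mat (length p) (length p)" by simp
  have d: "d \<in> carrier_vec m"
    unfolding d_def by (rule mult_mat_vec_carrier[OF _ cq(1)]) simp
  have Gd: "G *\<^sub>v d \<in> carrier_vec m" by (rule mult_mat_vec_carrier[OF G(1) d])
  have z: "z \<in> carrier_vec m" using g Gd by (simp add: z_def)
  have b: "b \<in> carrier_vec (length p)" by (simp add: b_def)
  have Kg: "?K *\<^sub>v g \<in> carrier_vec m" by (rule mult_mat_vec_carrier[OF K(1) g])
  have "sub_vec (G *\<^sub>v d) q = sub_vec g q"
    using sub_mat_mult_vec[OF G(1) _ cq(1), of q] sub_cols_mult_vec[OF G(1) _ cq(1)] cq(2) q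
    by (simp add: d_def)
  then have eq: "(G *\<^sub>v d) $ (q ! k) = g $ (q ! k)" if "k < length q" for k
    using that by (auto simp: sub_vec_def vec_eq_iff)
  have "z $ i = 0" if i: "i < m" "i \<notin> set p" for i
  proof -
    from i have "i \<in> set q" by (simp add: q)
    then obtain k where "k < length q" "q ! k = i" by (auto simp: in_set_conv_nth)
    then show ?thesis using eq[of k] i carrier_vecD[OF Gd] by (simp add: z_def)
  qed
  then have Eb: "sub_cols (1\<^sub>m m) p *\<^sub>v b = z"
    unfolding b_def by (rule extend_by_zero_sub_vec[OF z p])
  have "?K *\<^sub>v (G *\<^sub>v d) = d" using assoc_mult_mat_vec[OF K(1) G(1) d] K(2) d by simp
  then have "?K *\<^sub>v z = ?K *\<^sub>v g - d"
    using mult_minus_distrib_mat_vec[OF K(1) g Gd] by (simp add: z_def)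
  then have Kb: "sub_cols ?K p *\<^sub>v b = ?K *\<^sub>v g - d"
    using sub_cols_mult_vec[OF K(1) p(1) b] Eb by simp
  have "?N *\<^sub>v b = sub_vec (?K *\<^sub>v g) p - sub_vec d p"
    using sub_mat_mult_vec[OF K(1) p(1) b] Kb sub_vec_minus[OF Kg d p(1)] by simp
  also have "sub_vec d p = 0\<^sub>v (length p)"
    unfolding d_def using q by (intro sub_vec_extend_by_zero_disjoint[OF cq(1) p(1)]) auto
  finally have "?N *\<^sub>v b = sub_vec (?K *\<^sub>v g) p" by simp
  then have "inv_mat ?N *\<^sub>v sub_vec (?K *\<^sub>v g) p = b"
    using assoc_mult_mat_vec[OF inv_mat(1)[OF N inv] N b] inv_mat(3)[OF N inv] b by simp
  moreover have "d = ?K *\<^sub>v g - (?K *\<^sub>v g - d)"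
    using d Kg by (auto simp: vec_eq_iff)
  ultimately show ?thesis using Kb by (simp add: d_def)
qed

lemma vec_norm2_eq_0_iff: "vec_norm2 z = 0 \<longleftrightarrow> z = 0\<^sub>v (dim_vec z)"
  by (auto simp: vec_norm2_def L2_set_eq_0_iff vec_eq_iff)

text \<open>
  Multiplying \<open>w = P P\<^sup>+ w\<close> by \<open>L\<close> turns \<open>P = (L\<^sup>-\<^sup>1)\<^sub>:\<^sub>,\<^sub>p\<close> into the selection matrix, so \<open>L w\<close>
  is the zero extension of \<open>P\<^sup>+ w\<close>. The rows of \<open>L\<close> indexed by \<open>p\<close> are the left inverse of
  \<open>P\<close> that makes its pseudoinverse well defined.
\<close>

lemma pinv_sub_cols_inv_mat:
  fixes L :: "real mat"
  assumes L: "L \<in> carrier_mat m m" "invertible_mat L"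
    and p: "set p \<subseteq> {..<m}" "distinct p"
  defines "P \<equiv> sub_cols (inv_mat L) p"
  shows pinv_sub_cols_inv_mat_carrier: "pinv P \<in> carrier_mat (length p) m"
    and sub_vec_mult_if_in_range:
      "w \<in> carrier_vec m \<Longrightarrow> P *\<^sub>v (pinv P *\<^sub>v w) = w \<Longrightarrow> sub_vec (L *\<^sub>v w) p = pinv P *\<^sub>v w"
proof -
  let ?E = "sub_cols (1\<^sub>m m) p :: real mat"
  have K: "inv_mat L \<in> carrier_mat m m" "L * inv_mat L = 1\<^sub>m m" using inv_mat[OF L] by auto
  have P: "P \<in> carrier_mat m (length p)" using K by (simp add: P_def)
  have E: "?E \<in> carrier_mat m (length p)" by simp
  have LP: "L * P = ?E"
    unfolding P_def sub_cols_eq_mult[OF K(1) p(1)]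
    using assoc_mult_mat[OF L(1) K(1) E] K(2) E by simp
  have C: "transpose_mat ?E * L \<in> carrier_mat (length p) m"
    by (rule mult_carrier_mat[OF _ L(1)]) (simp add: sub_cols_def sub_mat_def)
  have "transpose_mat ?E * L * P = transpose_mat ?E * ?E"
    using assoc_mult_mat[OF _ L(1) P, of "transpose_mat ?E"] LP E by fastforce
  also have "\<dots> = 1\<^sub>m (length p)"
  proof (rule eq_matI)
    fix i j assume "i < dim_row (1\<^sub>m (length p) :: real mat)" "j < dim_col (1\<^sub>m (length p) :: real mat)"
    then have i: "i < length p" and j: "j < length p" by auto
    have less: "p ! k < m" if "k < length p" for k using that p(1) nth_mem by blast
    have "(transpose_mat ?E * ?E) $$ (i, j)
        = (\<Sum>a<m. (if a = p ! i then 1 else 0) * (if a = p ! j then 1 else 0))"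
      using i j less by (simp add: sub_cols_def sub_mat_def scalar_prod_def atLeast0LessThan)
    also have "\<dots> = (if p ! i = p ! j then 1 else 0)"
      using less[OF i] by (simp add: if_distrib[of "\<lambda>t. t * _"] cong: if_cong)
    finally show "(transpose_mat ?E * ?E) $$ (i, j) = 1\<^sub>m (length p) $$ (i, j)"
      using i j p(2) by (simp add: nth_eq_iff_index_eq)
  qed (simp_all add: sub_cols_def sub_mat_def)
  finally show pinv: "pinv P \<in> carrier_mat (length p) m"
    by (rule pinv_carrier_if_left_inverse[OF P C])
  show "sub_vec (L *\<^sub>v w) p = pinv P *\<^sub>v w"
    if w: "w \<in> carrier_vec m" and range: "P *\<^sub>v (pinv P *\<^sub>v w) = w"
  proof -
    have b: "pinv P *\<^sub>v w \<in> carrier_vec (length p)" by (rule mult_mat_vec_carrier[OF pinv w])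
    have "L *\<^sub>v w = L *\<^sub>v (P *\<^sub>v (pinv P *\<^sub>v w))" by (simp add: range)
    also have "\<dots> = ?E *\<^sub>v (pinv P *\<^sub>v w)"
      using assoc_mult_mat_vec[OF L(1) P b] LP by simp
    finally show ?thesis using sub_vec_extend_by_zero[OF b p] by simp
  qed
qed

lemma approximant_at_nodes:
  assumes "c \<in> carrier_vec (length q)" "set q \<subseteq> {..<m}" "i < m"
  shows "approximant lam \<kappa> q c (x i) =
    (evaluation_matrix m x lam \<kappa> *\<^sub>v (sub_cols (1\<^sub>m m) q *\<^sub>v c)) $ i"
proof -
  let ?L = "evaluation_matrix m x lam \<kappa>"
  have L: "?L \<in> carrier_mat m m" by (simp add: evaluation_matrix_def collocation_matrix_def)
  have "q ! k < m" if "k < length q" for k using that assms(2) nth_mem by blast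
  then have "(sub_cols ?L q *\<^sub>v c) $ i = approximant lam \<kappa> q c (x i)"
    unfolding sub_cols_mult_vec_nth[OF L assms(1,3)] approximant_def
    using assms(3)
    by (auto intro!: sum.cong simp: evaluation_matrix_def collocation_matrix_def point_eval_def)
  then show ?thesis using sub_cols_mult_vec[OF L assms(2,1)] by simp
qed

theorem theorem1:
  fixes \<Omega> :: "'a::euclidean_space set"
    and \<kappa> :: "'a \<Rightarrow> 'a \<Rightarrow> real"
    and x :: "nat \<Rightarrow> 'a"
    and h :: "'a \<Rightarrow> real"
    and \<gamma> lam :: "nat \<Rightarrow> ('a \<Rightarrow> real) \<Rightarrow> real"
    and D\<^sub>\<gamma> D\<^sub>l :: "('a \<Rightarrow> real) set"
    and m k v :: nat
    and folds :: "'a set set" and X\<^sub>l :: "'a set"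
    and p :: "nat list"
    and G L :: "real mat"
    and g c c\<^sub>p hv f e \<epsilon> :: "real vec"
    and s s\<^sub>p :: "'a \<Rightarrow> real"
  assumes kernel: "strictly_pos_def_kernel \<Omega> \<kappa>" "radial_kernel \<Omega> \<kappa>"
    and points: "inj_on x {..<m}" "x ` {..<m} \<subseteq> \<Omega>"
    and functionals: "distinct_linear_functionals \<Omega> D\<^sub>\<gamma> m \<gamma>"
      "distinct_linear_functionals \<Omega> D\<^sub>l m lam"
    and well_defined: "h \<in> D\<^sub>\<gamma>"
      "\<And>y. y \<in> \<Omega> \<Longrightarrow> \<kappa> y \<in> D\<^sub>l"
      "\<And>j. j < m \<Longrightarrow> (\<lambda>y. lam j (\<kappa> y)) \<in> D\<^sub>\<gamma>"
    and folds: "partition_on (x ` {..<m}) folds" "card folds = k" "k \<le> m" "m = k * v"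
      "\<And>F. F \<in> folds \<Longrightarrow> card F = v"
    and fold: "X\<^sub>l \<in> folds"
      "length p = v" "distinct p" "set p \<subseteq> {..<m}" "x ` set p = X\<^sub>l"
    and g: "g = vec m (\<lambda>i. \<gamma> i h)"
    and G: "G = collocation_matrix m \<gamma> lam \<kappa>" "invertible_mat G"
    and L: "L = evaluation_matrix m x lam \<kappa>" "invertible_mat L"
    and s: "c \<in> carrier_vec m" "G *\<^sub>v c = g" "s = approximant lam \<kappa> [0..<m] c"
    and Gpp: "invertible_mat (sub_mat (inv_mat G) p p)"
    and s\<^sub>p: "c\<^sub>p \<in> carrier_vec (m - v)"
      "sub_mat G (compl_indices m p) (compl_indices m p) *\<^sub>v c\<^sub>p = sub_vec g (compl_indices m p)"
      "s\<^sub>p = approximant lam \<kappa> (compl_indices m p) c\<^sub>p"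
    and hv: "hv = vec m (\<lambda>i. h (x i))"
    and f: "f = L * inv_mat G *\<^sub>v g"
    and e: "e = sub_vec hv p - vec v (\<lambda>i. s\<^sub>p (x (p ! i)))"
    and \<epsilon>: "\<epsilon> = pinv (sub_cols (inv_mat L) p) * sub_cols (inv_mat G) p
        * inv_mat (sub_mat (inv_mat G) p p) *\<^sub>v sub_vec (inv_mat G *\<^sub>v g) p
        - sub_vec f p + sub_vec hv p"
    and residual: "vec_norm2 ((sub_cols (inv_mat L) p * pinv (sub_cols (inv_mat L) p) - 1\<^sub>m m)
        * sub_cols (inv_mat G) p * inv_mat (sub_mat (inv_mat G) p p)
        *\<^sub>v sub_vec (inv_mat G *\<^sub>v g) p) = 0"
  shows "e = \<epsilon>"
proof -
  define q where "q = compl_indices m p"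
  define K where "K = inv_mat G"
  define P where "P = sub_cols (inv_mat L) p"
  define N where "N = inv_mat (sub_mat K p p)"
  define u where "u = sub_vec (K *\<^sub>v g) p"
  define w where "w = sub_cols K p *\<^sub>v (N *\<^sub>v u)"
  define d where "d = sub_cols (1\<^sub>m m) q *\<^sub>v c\<^sub>p"
  have p: "set p \<subseteq> {..<m}" "distinct p" "length p = v" using fold by auto
  have q: "set q \<subseteq> {..<m}" "length q = m - v"
    using length_compl_indices[OF p(2,1)] p(3) by (auto simp: q_def set_compl_indices)
  have Gc: "G \<in> carrier_mat m m" and Lc: "L \<in> carrier_mat m m"
    by (simp_all add: G L evaluation_matrix_def collocation_matrix_def)
  have gc: "g \<in> carrier_vec m" by (simp add: g)
  have Kc: "K \<in> carrier_mat m m" using inv_mat(1)[OF Gc G(2)] by (simp add: K_def)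
  have Nc: "N \<in> carrier_mat v v"
    unfolding N_def K_def using Gpp p(3) by (intro inv_mat(1)) auto
  have KP: "sub_cols K p \<in> carrier_mat m v" using Kc p(3) by auto
  have Pc: "P \<in> carrier_mat m v"
    using inv_mat(1)[OF Lc L(2)] p(3) by (auto simp: P_def)
  have pinv: "pinv P \<in> carrier_mat v m"
    using pinv_sub_cols_inv_mat_carrier[OF Lc L(2) p(1,2)] p(3) by (simp add: P_def)
  have uc: "u \<in> carrier_vec v" unfolding u_def p(3)[symmetric] by simp
  have Nu: "N *\<^sub>v u \<in> carrier_vec v" by (rule mult_mat_vec_carrier[OF Nc uc])
  have wc: "w \<in> carrier_vec m" unfolding w_def by (rule mult_mat_vec_carrier[OF KP Nu])
  have Kg: "K *\<^sub>v g \<in> carrier_vec m" by (rule mult_mat_vec_carrier[OF Kc gc])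
  have factor: "M * sub_cols K p * N *\<^sub>v u = M *\<^sub>v w" if M: "M \<in> carrier_mat r m" for M r
    using assoc_mult_mat_vec[OF mult_carrier_mat[OF M KP] Nc uc] assoc_mult_mat_vec[OF M KP Nu]
    by (simp add: w_def)
  have PP: "P * pinv P \<in> carrier_mat m m" by (rule mult_carrier_mat[OF Pc pinv])
  have "(P * pinv P - 1\<^sub>m m) *\<^sub>v w = 0\<^sub>v m"
    using residual factor[OF minus_carrier_mat[OF one_carrier_mat], of "P * pinv P"]
    unfolding P_def[symmetric] K_def[symmetric] N_def[symmetric] u_def[symmetric]
    by (simp add: vec_norm2_eq_0_iff)
  then have "P * pinv P *\<^sub>v w - w = 0\<^sub>v m"
    using minus_mult_distrib_mat_vec[OF PP _ wc, of "1\<^sub>m m"] wc by simp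
  then have "P * pinv P *\<^sub>v w = w"
    using wc PP by (auto simp: vec_eq_iff)
  then have "P *\<^sub>v (pinv P *\<^sub>v w) = w"
    using assoc_mult_mat_vec[OF Pc pinv wc] by simp
  then have Lw: "sub_vec (L *\<^sub>v w) p = pinv P *\<^sub>v w"
    using sub_vec_mult_if_in_range[OF Lc L(2) p(1,2) wc] by (simp add: P_def)
  have cq: "c\<^sub>p \<in> carrier_vec (length q)" using s\<^sub>p(1) q(2) by simp
  have "d = K *\<^sub>v g - w"
    using leave_out_coefficients[OF Gc G(2) gc p(1,2) Gpp] cq s\<^sub>p(2)
    by (simp add: d_def w_def q_def K_def N_def u_def)
  then have "L *\<^sub>v d = f - L *\<^sub>v w"
    using mult_minus_distrib_mat_vec[OF Lc Kg wc] assoc_mult_mat_vec[OF Lc Kc gc]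
    by (simp add: f K_def)
  moreover have fc: "f \<in> carrier_vec m"
    unfolding f by (rule mult_mat_vec_carrier[OF _ gc]) (use Lc Kc in \<open>auto simp: K_def\<close>)
  moreover have Lwc: "L *\<^sub>v w \<in> carrier_vec m" by (rule mult_mat_vec_carrier[OF Lc wc])
  ultimately have Ld: "sub_vec (L *\<^sub>v d) p = sub_vec f p - pinv P *\<^sub>v w"
    using sub_vec_minus[OF fc Lwc p(1)] Lw by simp
  have "p ! i < m" if "i < v" for i using that p nth_mem by blast
  then have "vec v (\<lambda>i. s\<^sub>p (x (p ! i))) = sub_vec (L *\<^sub>v d) p"
    using approximant_at_nodes[OF cq q(1), of _ lam \<kappa> x] p(3)
    unfolding sub_vec_def s\<^sub>p(3) q_def[symmetric] d_def L(1)
    by (intro eq_vecI) simp_all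
  then have "e = sub_vec hv p - (sub_vec f p - pinv P *\<^sub>v w)" by (simp add: e Ld)
  also have "\<dots> = pinv P *\<^sub>v w - sub_vec f p + sub_vec hv p"
    using pinv wc p(3) by (auto simp: vec_eq_iff sub_vec_def)
  also have "\<dots> = \<epsilon>"
    using factor[OF pinv] by (simp add: \<epsilon> P_def K_def N_def u_def)
  finally show ?thesis .
qed

end
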